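(* Let $0\le k<1$ and $M\ge 0$ with $k+M<1$, and let $f=h+\overline{g}\in\mathcal{H}^0_{k,M}$. Assume additionally that $$\beta(h)=\sup_{z\in\mathbb{D}}(1-|z|^2)|h'(z)|\le A$$ for some $A\ge 1$. Then $f$ is univalent in the disk $\mathbb{D}_{r_A}$, where $$r_A=\frac{3(1-k-M)}{64A}.$$ Moreover, $f(\mathbb{D}_{r_A})$ contains a disk centered at $0$ of radius at least $$R_{k,M,A}=\frac{3(1-k-M)^2}{128A}.$$
   Context: $\mathbb{D}=\{z\in\mathbb{C}:|z|<1\}$ and $\mathbb{D}_r=\{z\in\mathbb{C}:|z|<r\}$. For an analytic function $\varphi$ in $\mathbb{D}$, $\|\varphi\|_\infty=\sup_{z\in\mathbb{D}}|\varphi(z)|$. Univalent means injective; disks are open. Class $\mathcal{H}_{k,M}$ ($0\le k<1$, $M\ge 0$): the harmonic mappings $f=h+\overline{g}$ in $\mathbb{D}$ such that (1) $h$ and $g$ are analytic in $\mathbb{D}$; (2) $g(0)=0$; (3) there exist analytic functions $\omega,\psi$ in $\mathbb{D}$ such that $g'(z)=\omega(z)h'(z)+\psi(z)$ for all $z\in\mathbb{D}$; (4) $\|\omega\|_\infty\le k$ and $\|\psi\|_\infty\le M$; (5) $f$ is sense-preserving, i.e. $|g'(z)|<|h'(z)|$ for all $z\in\mathbb{D}$. Class $\mathcal{H}^0_{k,M}$: those $f=h+\overline{g}\in\mathcal{H}_{k,M}$ satisfying $f(0)=0$, $h'(0)=1$ and $g(0)=0$. *)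

theory Defs
  imports "HOL-Complex_Analysis.Complex_Analysis" "HOL-Library.Extended_Real"
begin

abbreviation unit_disk :: "complex set" where
  "unit_disk \<equiv> ball 0 1"

text \<open>
  The two suprema below are extended reals, so that for an unbounded function they are
  infinite; the real-valued supremum would be unspecified there.
\<close>

definition sup_norm_disk :: "(complex \<Rightarrow> complex) \<Rightarrow> ereal" where
  "sup_norm_disk \<phi> = (SUP z\<in>unit_disk. ereal (cmod (\<phi> z)))"

definition bloch_seminorm :: "(complex \<Rightarrow> complex) \<Rightarrow> ereal" where
  "bloch_seminorm h = (SUP z\<in>unit_disk. ereal ((1 - (cmod z)\<^sup>2) * cmod (deriv h z)))"

text \<open>
  Membership of \<open>f = h + cnj g\<close> in the class \<open>H\<^sub>k\<^sub>,\<^sub>M\<close>. The decomposition is an explicit argument,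
  since statements about \<open>f\<close> refer to \<open>h\<close> and \<open>g\<close>; it is determined by \<open>f\<close> on the disk because of
  the normalisation \<open>g 0 = 0\<close>. The functions are total in HOL, but only their values on the
  disk matter.
\<close>

definition harmonic_class ::
  "real \<Rightarrow> real \<Rightarrow> (complex \<Rightarrow> complex) \<Rightarrow> (complex \<Rightarrow> complex) \<Rightarrow> (complex \<Rightarrow> complex) \<Rightarrow> bool" where
  "harmonic_class k M f h g \<longleftrightarrow>
     (\<forall>z\<in>unit_disk. f z = h z + cnj (g z)) \<and>
     h analytic_on unit_disk \<and> g analytic_on unit_disk \<and>
     g 0 = 0 \<and>
     (\<exists>\<omega> \<psi>. \<omega> analytic_on unit_disk \<and> \<psi> analytic_on unit_disk \<and>
        (\<forall>z\<in>unit_disk. deriv g z = \<omega> z * deriv h z + \<psi> z) \<and>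
        sup_norm_disk \<omega> \<le> ereal k \<and> sup_norm_disk \<psi> \<le> ereal M) \<and>
     (\<forall>z\<in>unit_disk. cmod (deriv g z) < cmod (deriv h z))"

definition harmonic_class0 ::
  "real \<Rightarrow> real \<Rightarrow> (complex \<Rightarrow> complex) \<Rightarrow> (complex \<Rightarrow> complex) \<Rightarrow> (complex \<Rightarrow> complex) \<Rightarrow> bool" where
  "harmonic_class0 k M f h g \<longleftrightarrow>
     harmonic_class k M f h g \<and> f 0 = 0 \<and> deriv h 0 = 1 \<and> g 0 = 0"

end

theory Submission
  imports Defs
begin

text \<open>
  The Bloch bound gives \<open>\<bar>h'\<bar> < 4A/3\<close> on the disk of radius \<open>1/2\<close>, so the Schwarz lemma there
  yields \<open>\<bar>h'(z) - 1\<bar> \<le> (14A/3) \<bar>z\<bar>\<close>, which is at most \<open>\<lambda>/4\<close> on the disk of radius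
  \<open>r = 3\<lambda>/(64A)\<close>, where \<open>\<lambda> = 1 - k - M\<close>. Since \<open>\<bar>g'\<bar> \<le> k \<bar>h'\<bar> + M\<close>, the map \<open>f - id\<close> is then
  Lipschitz with constant \<open>1 - \<lambda>/2\<close> on that disk. Hence \<open>f\<close> is injective there, and by the
  contraction principle its image contains the disk of radius \<open>\<lambda>r/2\<close>.
\<close>

lemma inj_on_perturbation_of_identity:
  fixes f :: "'a::real_normed_vector \<Rightarrow> 'a"
  assumes "q < 1"
    and lip: "\<And>x y. x \<in> S \<Longrightarrow> y \<in> S \<Longrightarrow> norm ((f x - x) - (f y - y)) \<le> q * norm (x - y)"
  shows "inj_on f S"
proof (rule inj_onI)
  fix x y assume "x \<in> S" "y \<in> S" "f x = f y"
  with lip[of x y] have "norm (x - y) \<le> q * norm (x - y)"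
    by (simp add: norm_minus_commute)
  then have "(1 - q) * norm (x - y) \<le> 0" by (simp add: algebra_simps)
  with \<open>q < 1\<close> show "x = y" by (simp add: mult_le_0_iff)
qed

text \<open>For fixed \<open>w\<close>, the equation \<open>f x = w\<close> says exactly that
  \<open>x\<close> is a fixed point of \<open>T x = w - (f x - x)\<close>, and \<open>T\<close>
  inherits the Lipschitz constant \<open>q < 1\<close> from \<open>f - id\<close>.\<close>

lemma ball_subset_image_perturbation_of_identity:
  fixes f :: "'a::banach \<Rightarrow> 'a"
  assumes q: "0 \<le> q" "q < 1" and f0: "f 0 = 0"
    and lip: "\<And>x y. x \<in> ball 0 r \<Longrightarrow> y \<in> ball 0 r \<Longrightarrow>
      norm ((f x - x) - (f y - y)) \<le> q * norm (x - y)"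
  shows "ball 0 ((1 - q) * r) \<subseteq> f ` ball 0 r"
proof
  fix w :: 'a assume w: "w \<in> ball 0 ((1 - q) * r)"
  \<comment> \<open>The radius \<open>s\<close> solves \<open>norm w + q * s = s\<close>, so the
    estimate for \<open>T\<close> sends \<open>cball 0 s\<close> into itself. The closed ball
    supplies completeness, and \<open>s < r\<close> keeps it inside the open ball where
    \<open>lip\<close> is available.\<close>
  define s where "s = norm w / (1 - q)"
  have s: "0 \<le> s" "s < r" "norm w + q * s = s"
    using w q by (auto simp: s_def field_simps)
  have sub: "x \<in> ball 0 r" if "x \<in> cball 0 s" for x :: 'a
    using that s by auto
  define T where "T x = w - (f x - x)" for x
  have "T ` cball 0 s \<subseteq> cball 0 s"
  proof clarify
    fix x :: 'a assume x: "x \<in> cball 0 s"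
    have "norm (T x) \<le> norm w + norm (f x - x)"
      unfolding T_def by (rule norm_triangle_ineq4)
    also have "norm (f x - x) \<le> q * norm x"
      using lip[of x 0] sub[OF x] s f0 by simp
    also have "q * norm x \<le> q * s"
      using x q by (intro mult_left_mono) auto
    finally show "T x \<in> cball 0 s" using s by simp
  qed
  moreover have "dist (T x) (T y) \<le> q * dist x y" if "x \<in> cball 0 s" "y \<in> cball 0 s" for x y
    using lip[OF sub[OF that(1)] sub[OF that(2)]]
    by (simp add: T_def dist_norm norm_minus_commute algebra_simps)
  ultimately have "\<exists>!x\<in>cball 0 s. T x = x"
    using q s by (intro Banach_fix) (auto simp: complete_eq_closed)
  then obtain x where "x \<in> cball 0 s" "T x = x" by blast
  then show "w \<in> f ` ball 0 r"
    using sub by (auto simp: T_def intro!: image_eqI[of _ _ x])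
qed

text \<open>Rescaling the domain by \<open>R\<close> and the values by \<open>B\<close> reduces this
  to the Schwarz lemma on the unit disk. The strict bound by \<open>B\<close> becomes the strict
  bound by 1 required there.\<close>

lemma Schwarz_linear_bound:
  assumes hol: "\<phi> holomorphic_on ball 0 R" and "0 < R" and "\<phi> 0 = 0"
    and B: "\<And>z. z \<in> ball 0 R \<Longrightarrow> cmod (\<phi> z) < B"
    and z: "z \<in> ball 0 R"
  shows "cmod (\<phi> z) \<le> B / R * cmod z"
proof -
  have "0 < B" using B[of 0] \<open>0 < R\<close> \<open>\<phi> 0 = 0\<close> by simp
  have scale: "of_real R * u \<in> ball 0 R" if "cmod u < 1" for u
    using that \<open>0 < R\<close> by (simp add: norm_mult)
  define F where "F u = \<phi> (of_real R * u) / of_real B" for u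
  have "F holomorphic_on ball 0 1"
    unfolding F_def using scale \<open>0 < B\<close>
    by (intro holomorphic_intros holomorphic_on_compose_gen[OF _ hol, unfolded o_def]) auto
  moreover have "cmod (F u) < 1" if "cmod u < 1" for u
    using B[OF scale[OF that]] \<open>0 < B\<close> by (simp add: F_def norm_divide)
  moreover have "F 0 = 0" using \<open>\<phi> 0 = 0\<close> by (simp add: F_def)
  moreover have "cmod (z / of_real R) < 1" using z \<open>0 < R\<close> by (simp add: norm_divide)
  ultimately have "cmod (F (z / of_real R)) \<le> cmod (z / of_real R)"
    using Schwarz_Lemma(1) by blast
  then show ?thesis
    using \<open>0 < R\<close> \<open>0 < B\<close> by (simp add: F_def norm_divide field_simps)
qed

lemma sup_norm_disk_leD:
  assumes "sup_norm_disk \<phi> \<le> ereal c" "z \<in> unit_disk"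
  shows "cmod (\<phi> z) \<le> c"
  using assms unfolding sup_norm_disk_def SUP_le_iff by auto

lemma bloch_seminorm_leD:
  assumes "bloch_seminorm h \<le> ereal A" "z \<in> unit_disk"
  shows "(1 - (cmod z)\<^sup>2) * cmod (deriv h z) \<le> A"
  using assms unfolding bloch_seminorm_def SUP_le_iff by auto

lemma bloch_deriv_deviation:
  assumes "h analytic_on unit_disk" "deriv h 0 = 1" "1 \<le> A"
    and bloch: "bloch_seminorm h \<le> ereal A"
    and z: "cmod z < 1 / 2"
  shows "cmod (deriv h z - 1) \<le> 14 * A / 3 * cmod z"
proof -
  have hol: "(\<lambda>z. deriv h z - 1) holomorphic_on ball 0 (1 / 2)"
    by (intro holomorphic_on_diff holomorphic_on_const
        holomorphic_on_subset[OF analytic_imp_holomorphic[OF analytic_deriv[OF assms(1)]]]) auto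
  \<comment> \<open>The constant is 4A/3 + A: the Bloch bound with 1 - |u|^2 > 3/4 gives the first
    term, and A \<ge> 1 absorbs the subtracted 1. Dividing by the radius 1/2 then yields the slope
    14A/3.\<close>
  have "cmod (deriv h u - 1) < 7 * A / 3" if "u \<in> ball 0 (1 / 2)" for u
  proof -
    have "(cmod u)\<^sup>2 < (1 / 2)\<^sup>2"
      using that by (intro power_strict_mono) auto
    then have u: "3 / 4 < 1 - (cmod u)\<^sup>2" by (simp add: power2_eq_square)
    have "cmod (deriv h u) < 4 * A / 3"
    proof (cases "deriv h u = 0")
      case False
      then have "3 / 4 * cmod (deriv h u) < (1 - (cmod u)\<^sup>2) * cmod (deriv h u)"
        using u by (intro mult_strict_right_mono) auto
      with bloch_seminorm_leD[OF bloch, of u] that show ?thesis by auto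
    qed (use \<open>1 \<le> A\<close> in simp)
    then show ?thesis
      using norm_triangle_ineq4[of "deriv h u" 1] \<open>1 \<le> A\<close> by simp
  qed
  from Schwarz_linear_bound[OF hol _ _ this, of z] show ?thesis
    using assms by simp
qed

theorem theorem3p4:
  fixes k M A :: real and f h g :: "complex \<Rightarrow> complex"
  assumes "0 \<le> k" and "k < 1" and "0 \<le> M" and "k + M < 1"
    and "harmonic_class0 k M f h g"
    and "1 \<le> A"
    and "bloch_seminorm h \<le> ereal A"
  shows "inj_on f (ball 0 (3 * (1 - k - M) / (64 * A)))
       \<and> (\<exists>\<rho>. 3 * (1 - k - M)\<^sup>2 / (128 * A) \<le> \<rho>
              \<and> ball 0 \<rho> \<subseteq> f ` ball 0 (3 * (1 - k - M) / (64 * A)))"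
proof -
  define l where "l = 1 - k - M"
  define r where "r = 3 * l / (64 * A)"
  have l: "0 < l" "l \<le> 1" using assms by (auto simp: l_def)
  have r: "0 < r" "r < 1 / 2" "A * r = 3 * l / 64"
    using l \<open>1 \<le> A\<close> by (auto simp: r_def field_simps)
  obtain \<omega> \<psi> where f: "\<And>z. z \<in> unit_disk \<Longrightarrow> f z = h z + cnj (g z)"
    and an: "h analytic_on unit_disk" "g analytic_on unit_disk"
    and g': "\<And>z. z \<in> unit_disk \<Longrightarrow> deriv g z = \<omega> z * deriv h z + \<psi> z"
    and sup: "sup_norm_disk \<omega> \<le> ereal k" "sup_norm_disk \<psi> \<le> ereal M"
    and f0: "f 0 = 0" and h'0: "deriv h 0 = 1"
    using assms(5) unfolding harmonic_class0_def harmonic_class_def by blast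
  have disk: "z \<in> unit_disk" if "z \<in> ball 0 r" for z :: complex
    using that r by auto
  have h'_bound: "cmod (deriv h z - 1) \<le> l / 4" if z: "z \<in> ball 0 r" for z
  proof -
    have "cmod (deriv h z - 1) \<le> 14 * A / 3 * cmod z"
      using bloch_deriv_deviation[OF an(1) h'0 assms(6,7)] z r by auto
    also have "\<dots> \<le> 14 * A / 3 * r"
      using z \<open>1 \<le> A\<close> by (intro mult_left_mono) auto
    \<comment> \<open>By the choice of \<open>r\<close>, the left side equals 7l/32.\<close>
    also have "\<dots> \<le> l / 4" using r l by simp
    finally show ?thesis .
  qed
  have g'_bound: "cmod (deriv g z) \<le> k + M + l / 4" if z: "z \<in> ball 0 r" for z
  proof -
    have "cmod (deriv h z) \<le> 1 + l / 4"
      using norm_triangle_sub[of "deriv h z" 1] h'_bound[OF z] by simp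
    then have "cmod (\<omega> z) * cmod (deriv h z) \<le> k * (1 + l / 4)"
      using sup_norm_disk_leD[OF sup(1) disk[OF z]] \<open>0 \<le> k\<close> by (intro mult_mono) auto
    \<comment> \<open>Replacing the factor \<open>k\<close> by 1 in the small term only keeps the
      bound linear in \<open>l\<close>.\<close>
    also have "\<dots> \<le> k + l / 4"
      using mult_right_mono[of k 1 "l / 4"] \<open>k < 1\<close> l by (simp add: algebra_simps)
    finally have "cmod (\<omega> z) * cmod (deriv h z) \<le> k + l / 4" .
    then show ?thesis
      using g'[OF disk[OF z]] sup_norm_disk_leD[OF sup(2) disk[OF z]]
        norm_triangle_ineq[of "\<omega> z * deriv h z" "\<psi> z"]
      by (simp add: norm_mult)
  qed
  have der: "(h has_field_derivative deriv h z) (at z within ball 0 r)"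
    "(g has_field_derivative deriv g z) (at z within ball 0 r)" if "z \<in> ball 0 r" for z
    using holomorphic_derivI[OF analytic_imp_holomorphic[OF an(1)] open_ball disk[OF that]]
      holomorphic_derivI[OF analytic_imp_holomorphic[OF an(2)] open_ball disk[OF that]]
    by blast+
  \<comment> \<open>This is the sum of the Lipschitz constants \<open>l / 4\<close> of
    \<open>h - id\<close> and \<open>k + M + l / 4\<close> of \<open>g\<close>, since
    \<open>k + M = 1 - l\<close>.\<close>
  define q where "q = 1 - l / 2"
  have q: "0 \<le> q" "q < 1" using l by (auto simp: q_def)
  have lip: "cmod ((f x - x) - (f y - y)) \<le> q * cmod (x - y)"
    if x: "x \<in> ball 0 r" and y: "y \<in> ball 0 r" for x y
  proof -
    have "cmod ((h x - x) - (h y - y)) \<le> l / 4 * cmod (x - y)"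
      by (rule field_differentiable_bound[OF convex_ball
            DERIV_diff[OF der(1) DERIV_ident] h'_bound x y])
    moreover have "cmod (g x - g y) \<le> (k + M + l / 4) * cmod (x - y)"
      by (rule field_differentiable_bound[OF convex_ball der(2) g'_bound x y])
    \<comment> \<open>As \<open>f\<close> itself need not be holomorphic, the mean value bounds are
      taken for \<open>h - id\<close> and \<open>g\<close> separately and combined here; conjugation
      preserves the modulus.\<close>
    moreover have "(f x - x) - (f y - y) = ((h x - x) - (h y - y)) + cnj (g x - g y)"
      using f[OF disk[OF x]] f[OF disk[OF y]] by simp
    then have "cmod ((f x - x) - (f y - y)) \<le> cmod ((h x - x) - (h y - y)) + cmod (g x - g y)"
      using norm_triangle_ineq[of "(h x - x) - (h y - y)" "cnj (g x - g y)"]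
      by (simp only: complex_mod_cnj)
    ultimately have "cmod ((f x - x) - (f y - y)) \<le> (l / 4 + (k + M + l / 4)) * cmod (x - y)"
      by (simp add: distrib_right)
    also have "l / 4 + (k + M + l / 4) = q" by (simp add: q_def l_def field_simps)
    finally show ?thesis .
  qed
  \<comment> \<open>The covering radius \<open>(1 - q) * r\<close> is exactly the claimed one, so it
    serves as the witness \<rho> with equality.\<close>
  have "(1 - q) * r = 3 * l\<^sup>2 / (128 * A)"
    by (simp add: q_def r_def power2_eq_square)
  then have "inj_on f (ball 0 r) \<and> (\<exists>\<rho>. 3 * l\<^sup>2 / (128 * A) \<le> \<rho> \<and> ball 0 \<rho> \<subseteq> f ` ball 0 r)"
    using inj_on_perturbation_of_identity[OF q(2) lip]
      ball_subset_image_perturbation_of_identity[OF q f0 lip] by fastforce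
  then show ?thesis by (simp add: r_def l_def)
qed

end
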